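(* Let $u,v$ be integers. (i) Suppose $u-1$ and $v-2$ are prime numbers. If $(u,v,P,\mathbb{Q})$ is true, then either $u=v=4$, or $u=3$ and $v=5$. (ii) If $|u-v+1|=1$, then $(u,v,P,\mathbb{Q})$ is true.
   Context: For integers $u,v$, the phrase "$(u,v,P,\mathbb{Q})$ is true" means: there exist $a,b\in\mathbb{Q}$ with $a\neq 0$ such that the polynomial $P(x,y)=axy+bx+by+\frac{b^2-b}{a}\in\mathbb{Q}[x,y]$, which defines a commutative group operation $x\oplus y=P(x,y)$ on the set $\mathbb{Q}\setminus\{-b/a\}$, satisfies $1\oplus 1=u$ and $2\oplus 2=v$, i.e. $P(1,1)=u$ and $P(2,2)=v$. (The conditions are on the values of the polynomial; it is not required that $1$ and $2$ differ from $-b/a$.) *)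

theory Defs
  imports Complex_Main "HOL-Computational_Algebra.Primes" "HOL-Algebra.Group"
begin

definition P_op :: "rat \<Rightarrow> rat \<Rightarrow> rat \<Rightarrow> rat \<Rightarrow> rat" where
  "P_op a b x y = a * x * y + b * x + b * y + (b\<^sup>2 - b) / a"

definition P_group :: "rat \<Rightarrow> rat \<Rightarrow> rat monoid" where
  "P_group a b = \<lparr>carrier = UNIV - {- b / a}, mult = P_op a b, one = (1 - b) / a\<rparr>"

text \<open>Being a commutative group operation is automatic for \<open>a \<noteq> 0\<close>, since
  \<open>P_op a b x y + b / a = a * (x + b / a) * (y + b / a)\<close>; this is why
  \<open>P_true\<close> below does not repeat it as a condition.\<close>

lemma P_op_shift:
  assumes "a \<noteq> 0"
  shows "P_op a b x y + b / a = a * (x + b / a) * (y + b / a)"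
  using assms by (simp add: P_op_def field_simps power2_eq_square)

lemma comm_group_P_group:
  assumes a: "a \<noteq> 0"
  shows "comm_group (P_group a b)"
proof (rule comm_groupI)
  fix x y z
  assume x: "x \<in> carrier (P_group a b)" and y: "y \<in> carrier (P_group a b)"
  show "x \<otimes>\<^bsub>P_group a b\<^esub> y \<in> carrier (P_group a b)"
    using x y a by (simp add: P_group_def eq_neg_iff_add_eq_0 P_op_shift)
next
  show "\<one>\<^bsub>P_group a b\<^esub> \<in> carrier (P_group a b)"
    using a by (simp add: P_group_def field_simps)
next
  fix x y z
  show "x \<otimes>\<^bsub>P_group a b\<^esub> y \<otimes>\<^bsub>P_group a b\<^esub> z = x \<otimes>\<^bsub>P_group a b\<^esub> (y \<otimes>\<^bsub>P_group a b\<^esub> z)"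
    using a by (simp add: P_group_def P_op_def field_simps power2_eq_square)
next
  fix x y
  show "x \<otimes>\<^bsub>P_group a b\<^esub> y = y \<otimes>\<^bsub>P_group a b\<^esub> x"
    by (simp add: P_group_def P_op_def algebra_simps)
next
  fix x
  show "\<one>\<^bsub>P_group a b\<^esub> \<otimes>\<^bsub>P_group a b\<^esub> x = x"
    using a by (simp add: P_group_def P_op_def field_simps power2_eq_square)
next
  fix x
  assume x: "x \<in> carrier (P_group a b)"
  define c where "c = b / a"
  have nz: "x + c \<noteq> 0"
    using x by (simp add: P_group_def c_def eq_neg_iff_add_eq_0)
  define y where "y = 1 / (a * a * (x + c)) - c"
  have yc: "y + c = 1 / (a * a * (x + c))" by (simp add: y_def)
  have "P_op a b y x + c = a * (y + c) * (x + c)"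
    using P_op_shift[OF a] by (simp add: c_def)
  also have "\<dots> = 1 / a" unfolding yc using nz a by simp
  finally have "P_op a b y x = (1 - b) / a"
    by (simp add: c_def diff_divide_distrib eq_diff_eq)
  moreover have "y + c \<noteq> 0" unfolding yc using nz a by simp
  ultimately show "\<exists>y\<in>carrier (P_group a b). y \<otimes>\<^bsub>P_group a b\<^esub> x = \<one>\<^bsub>P_group a b\<^esub>"
    by (intro bexI[of _ y]) (auto simp: P_group_def c_def eq_neg_iff_add_eq_0)
qed

definition P_true :: "int \<Rightarrow> int \<Rightarrow> bool" where
  "P_true u v \<longleftrightarrow>
     (\<exists>a b. a \<noteq> 0 \<and> P_op a b 1 1 = of_int u \<and> P_op a b 2 2 = of_int v)"

end

theory Submission
  imports Defs
begin

text \<open>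
  Put \<open>p = u - 1\<close>, \<open>q = v - 2\<close> and \<open>s = a + b\<close>. The two conditions on \<open>a\<close> and \<open>b\<close> become
  \<open>s (s - 1) = p a\<close> and \<open>(s + a) (s + a - 1) = q a\<close>. Subtracting and cancelling \<open>a\<close> leaves
  \<open>a = q - p + 1 - 2 s\<close>, a linear relation, so everything reduces to one quadratic equation
  for \<open>s\<close> with integer coefficients and discriminant \<open>4 p q + 1\<close>. It has a rational root exactly
  when this odd number is a square \<open>(2 k + 1)\<^sup>2\<close>, that is, when \<open>p q\<close> is the product
  \<open>k (k + 1)\<close> of two consecutive integers. This criterion (\<open>P_true_iff_pronic\<close>) gives both parts:
  if \<open>p\<close> and \<open>q\<close> are prime, unique factorisation forces them to be consecutive themselves
  (\<open>prime_product_pronic\<close>), hence to be 2 and 3 in some order; conversely, \<open>\<bar>u - v + 1\<bar> = 1\<close>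
  says precisely that \<open>p\<close> and \<open>q\<close> are consecutive.
\<close>

lemma rat_square_eq_int_imp_int:
  fixes r :: rat and d :: int
  assumes "r\<^sup>2 = of_int d"
  obtains m where "r = of_int m"
proof -
  obtain x y :: int where r: "r = of_int x / of_int y" and y: "y > 0"
    by (metis quotient_of_denom_pos quotient_of_div surj_pair)
  have "(of_int (x\<^sup>2) :: rat) = of_int (d * y\<^sup>2)"
    using assms y by (simp add: r power_divide field_simps)
  then have "y\<^sup>2 dvd x\<^sup>2"
    by (metis dvd_triv_right of_int_eq_iff)
  then obtain m where "x = y * m"
    by (auto simp: pow_divides_pow_iff)
  then have "r = of_int m"
    using y by (simp add: r)
  then show ?thesis ..
qed

lemma P_true_imp_pronic:
  assumes "P_true u v"
  shows "\<exists>k. (u - 1) * (v - 2) = k * (k + 1)"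
proof -
  define p q where "p = u - 1" and "q = v - 2"
  obtain a b where a: "a \<noteq> 0" and "P_op a b 1 1 = of_int u" "P_op a b 2 2 = of_int v"
    using assms by (auto simp: P_true_def)
  moreover define s where "s = a + b"
  ultimately have p: "s * (s - 1) = of_int p * a" and q: "(s + a) * (s + a - 1) = of_int q * a"
    by (auto simp: P_op_def p_def q_def field_simps power2_eq_square)
  have "a * (of_int q - of_int p + 1 - 2 * s - a) = 0"
    using p q by (simp add: algebra_simps)
  with a have lin: "a = of_int q - of_int p + 1 - 2 * s"
    by simp
  have "(2 * s + 2 * of_int p - 1)\<^sup>2 = of_int (4 * p * q + 1)"
    using p by (simp add: lin power2_eq_square algebra_simps)
  then obtain m where "2 * s + 2 * of_int p - 1 = of_int m"
    by (rule rat_square_eq_int_imp_int)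
  with \<open>(2 * s + 2 * of_int p - 1)\<^sup>2 = _\<close> have m: "m\<^sup>2 = 4 * p * q + 1"
    by (metis of_int_eq_iff of_int_power)
  then have "odd (m\<^sup>2)"
    by simp
  then have "odd m"
    by simp
  then obtain k where "m = 2 * k + 1"
    by (auto elim: oddE)
  with m have "p * q = k * (k + 1)"
    by (simp add: power2_eq_square algebra_simps)
  then show ?thesis
    unfolding p_def q_def ..
qed

text \<open>
  A root of the quadratic for \<open>s\<close> is useless if it makes \<open>a\<close> vanish. The two roots, which
  correspond to \<open>k\<close> and \<open>- k - 1\<close>, give \<open>a = p + q + (2 k + 1)\<close> and \<open>a = p + q - (2 k + 1)\<close>;
  these differ by twice an odd number, so at least one of them is nonzero.
\<close>
lemma pronic_imp_P_true:
  assumes "(u - 1) * (v - 2) = k * (k + 1)"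
  shows "P_true u v"
proof -
  define p q where "p = u - 1" and "q = v - 2"
  have main: "P_true u v" if l: "p * q = l * (l + 1)" and nz: "p + q + 2 * l + 1 \<noteq> 0" for l
  proof -
    \<comment> \<open>The root is \<open>s = - p - l\<close>, and \<open>b = s - a\<close>.\<close>
    define a b :: rat where "a = of_int (p + q + 2 * l + 1)"
      and "b = of_int (- 2 * p - q - 3 * l - 1)"
    have a0: "a \<noteq> 0"
      unfolding a_def using nz by (simp only: of_int_eq_0_iff) simp
    have uv: "u = p + 1" "v = q + 2"
      by (simp_all add: p_def q_def)
    have lr: "(of_int p * of_int q :: rat) = of_int l * (of_int l + 1)"
      using l by (metis of_int_1 of_int_add of_int_mult)
    have "a * a + 2 * b * a + (b\<^sup>2 - b) = of_int u * a"
      using lr by (simp add: uv a_def b_def power2_eq_square algebra_simps)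
    moreover have "4 * a * a + 4 * b * a + (b\<^sup>2 - b) = of_int v * a"
      using lr by (simp add: uv a_def b_def power2_eq_square algebra_simps)
    ultimately have "P_op a b 1 1 = of_int u" "P_op a b 2 2 = of_int v"
      using a0 by (simp_all add: P_op_def field_simps)
    with a0 show ?thesis
      by (auto simp: P_true_def)
  qed
  have k: "p * q = k * (k + 1)"
    using assms by (simp add: p_def q_def)
  show ?thesis
  proof (cases "p + q + 2 * k + 1 = 0")
    case False
    with k show ?thesis by (rule main)
  next
    case True
    show ?thesis
    proof (rule main)
      show "p * q = (- k - 1) * ((- k - 1) + 1)"
        using k by (simp add: algebra_simps)
      show "p + q + 2 * (- k - 1) + 1 \<noteq> 0"
        using True by presburger
    qed
  qed
qed

theorem P_true_iff_pronic: "P_true u v \<longleftrightarrow> (\<exists>k. (u - 1) * (v - 2) = k * (k + 1))"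
  using P_true_imp_pronic pronic_imp_P_true by blast

lemma consecutive_primes:
  fixes n :: int
  assumes "prime n" "prime (n + 1)"
  shows "n = 2"
proof (rule ccontr)
  assume "n \<noteq> 2"
  with assms have "n > 2"
    using prime_ge_2_int[of n] by simp
  with assms show False
    using prime_odd_int[of n] prime_odd_int[of "n + 1"] by simp
qed

lemma prime_product_pronic:
  fixes p q k :: int
  assumes p: "prime p" and q: "prime q" and k: "p * q = k * (k + 1)"
  shows "p = q + 1 \<or> q = p + 1"
proof -
  \<comment> \<open>The involution \<open>k \<mapsto> - k - 1\<close> preserves \<open>k (k + 1)\<close>.\<close>
  obtain n :: int where n: "p * q = n * (n + 1)" and n0: "n \<ge> 0"
  proof (cases "k \<ge> 0")
    case True
    with k that show ?thesis by blast
  next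
    case False
    with k that[of "- k - 1"] show ?thesis by (simp add: algebra_simps)
  qed
  have pq: "p \<ge> 2" "q \<ge> 2"
    using p q by (simp_all add: prime_ge_2_int)
  have split_q: "x = 1 \<or> y = 1" if "q = x * y" "x > 0" "y > 0" for x y
    using irreducibleD[OF prime_elem_imp_irreducible that(1)] q that by auto
  have "n \<noteq> 0"
    using n pq by auto
  with n0 have n1: "n \<ge> 1"
    by simp
  have "p dvd n * (n + 1)"
    by (metis n dvd_triv_left)
  then consider c where "n = p * c" | c where "n + 1 = p * c"
    using p by (auto simp: prime_dvd_mult_iff elim: dvdE)
  then show ?thesis
  proof cases
    case 1
    then have c: "q = c * (n + 1)"
      using n pq by auto
    have "c > 0"
      using 1 n1 pq zero_less_mult_iff[of p c] by linarith
    then have "c = 1"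
      using split_q[OF c] n1 by auto
    with 1 c show ?thesis by simp
  next
    case 2
    then have c: "q = n * c"
      using n pq by auto
    have "c > 0"
      using 2 n1 pq zero_less_mult_iff[of p c] by linarith
    then consider "n = 1" | "c = 1"
      using split_q[OF c] n1 by auto
    then show ?thesis
    proof cases
      case 1
      \<comment> \<open>Then \<open>p * q = 2\<close>, which is too small for two primes.\<close>
      then show ?thesis
        using n pq mult_mono[of 2 p 2 q] by simp
    next
      case 2
      with c \<open>n + 1 = p * c\<close> show ?thesis by simp
    qed
  qed
qed

theorem theorem1:
  fixes u v :: int
  shows "(prime (u - 1) \<and> prime (v - 2) \<and> P_true u v \<longrightarrow>
            (u = 4 \<and> v = 4) \<or> (u = 3 \<and> v = 5)) \<and>
         (\<bar>u - v + 1\<bar> = 1 \<longrightarrow> P_true u v)"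
proof (intro conjI impI)
  assume "prime (u - 1) \<and> prime (v - 2) \<and> P_true u v"
  then have p: "prime (u - 1)" and q: "prime (v - 2)"
    and "\<exists>k. (u - 1) * (v - 2) = k * (k + 1)"
    by (auto simp: P_true_iff_pronic)
  then have "u - 1 = (v - 2) + 1 \<or> v - 2 = (u - 1) + 1"
    using prime_product_pronic by blast
  then show "(u = 4 \<and> v = 4) \<or> (u = 3 \<and> v = 5)"
  proof
    assume e: "u - 1 = (v - 2) + 1"
    then have "v - 2 = 2"
      using consecutive_primes[OF q] p by simp
    with e show ?thesis by simp
  next
    assume e: "v - 2 = (u - 1) + 1"
    then have "u - 1 = 2"
      using consecutive_primes[OF p] q by simp
    with e show ?thesis by simp
  qed
next
  assume "\<bar>u - v + 1\<bar> = 1"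
  then consider "v - 2 = (u - 1) + 1" | "u - 1 = (v - 2) + 1"
    by linarith
  then show "P_true u v"
    unfolding P_true_iff_pronic by cases (metis, metis mult.commute)
qed

end
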